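(* Let $\underline{\hat n}_1,\underline{\hat n}_2\in\mathbb{R}^3$ be two orthogonal unit vectors, let $(u^0,u^1,u^2)\in\mathbb{R}^3$ satisfy $(u^0)^2+(u^1)^2+(u^2)^2=1$, and put $\underline{u}=u^1\underline{\hat n}_1+u^2\underline{\hat n}_2$. For each choice of sign $\pm$, define $$(R^\pm)^{\lambda\alpha}_{\beta\mu}=u^0\,\delta^\lambda_\mu\delta^\alpha_\beta+\mathrm{i}\,(J^\pm_{\underline{\hat n}_1})^\lambda_\mu\,(J^\pm_{\underline{u}})^\alpha_\beta,\qquad\lambda,\mu,\alpha,\beta\in\{0,1,2,3\}.$$ Then $R=R^\pm$ satisfies, for all values of the free indices, $$R^{\lambda\beta}_{\alpha\mu}=R^{\mu\alpha}_{\beta\lambda}=(R^{-1})^{\beta\mu}_{\lambda\alpha}=\overline{R}^{\mu\beta}_{\alpha\lambda}$$ and $$R^{\lambda\alpha}_{\beta\rho}R^{\rho\delta}_{\gamma\mu}=R^{\lambda\delta}_{\gamma\rho}R^{\rho\alpha}_{\beta\mu},\qquad R^{\lambda\alpha}_{\gamma\nu}R^{\mu\gamma}_{\beta\rho}=R^{\mu\alpha}_{\gamma\rho}R^{\lambda\gamma}_{\beta\nu},$$ i.e. $R^\pm$ defines a noncommutative product of two four-dimensional Euclidean spaces.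
   Context: Repeated up-down indices are summed over $\{0,1,2,3\}$; the bar is complex conjugation. $R^{-1}$ denotes the inverse matrix, defined by $(R^{-1})^{\alpha\lambda}_{\mu\beta}R^{\mu\beta}_{\gamma\nu}=\delta^\lambda_\nu\delta^\alpha_\gamma$. Identify the quaternions $\mathbb{H}$ with $\mathbb{R}^4$ by $q=x^0+x^1e_1+x^2e_2+x^3e_3\mapsto(x^0,x^1,x^2,x^3)$, where $e_ae_b=-\delta_{ab}+\sum_c\varepsilon_{abc}e_c$. For $a=1,2,3$, $J^+_a$ is the real $4\times4$ matrix of left multiplication $q\mapsto e_aq$ and $J^-_a$ is minus the matrix of right multiplication $q\mapsto qe_a$. These are antisymmetric matrices satisfying $J^+_aJ^-_b=J^-_bJ^+_a$ and $J^\pm_aJ^\pm_b=-\delta_{ab}1+\sum_c\varepsilon_{abc}J^\pm_c$. For $\underline{w}=(w^1,w^2,w^3)\in\mathbb{R}^3$ put $J^\pm_{\underline{w}}=w^1J^\pm_1+w^2J^\pm_2+w^3J^\pm_3$. The relations displayed in the claim are those characterising when the algebra generated by hermitian elements $x_1^\lambda,x_2^\alpha$ with relations $x_1^\lambda x_1^\mu=x_1^\mu x_1^\lambda$, $x_2^\alpha x_2^\beta=x_2^\beta x_2^\alpha$, $x_1^\lambda x_2^\alpha=R^{\lambda\alpha}_{\beta\mu}x_2^\beta x_1^\mu$ is said to define a noncommutative product of Euclidean spaces. *)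

theory Defs
  imports "HOL-Analysis.Analysis"
begin

unbundle cross3_syntax

text \<open>
  Quaternions are vectors in \<^typ>\<open>real^4\<close>, whose index type has the elements
  \<open>0, 1, 2, 3\<close>. In the numeral types \<open>4 = 0\<close> and, in \<^typ>\<open>3\<close>, \<open>3 = 0\<close>; the
  coordinates of \<^typ>\<open>real^3\<close> are referred to as \<open>1, 2, 3\<close>.
\<close>

definition quat :: "real \<Rightarrow> real^3 \<Rightarrow> real^4" where
  "quat t v = (\<chi> i. if i = 0 then t else if i = 1 then v $ 1 else if i = 2 then v $ 2 else v $ 3)"

definition quat_im :: "real^4 \<Rightarrow> real^3" where
  "quat_im q = vector [q $ 1, q $ 2, q $ 3]"

text \<open>
  The bilinear extension of \<open>e\<^sub>a e\<^sub>b = -\<delta>\<^sub>a\<^sub>b + \<Sum>\<^sub>c \<epsilon>\<^sub>a\<^sub>b\<^sub>c e\<^sub>c\<close>, with unit \<open>quat 1 0\<close>.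
\<close>
definition quat_mult :: "real^4 \<Rightarrow> real^4 \<Rightarrow> real^4" where
  "quat_mult p q =
     quat (p $ 0 * q $ 0 - quat_im p \<bullet> quat_im q)
          (p $ 0 *\<^sub>R quat_im q + q $ 0 *\<^sub>R quat_im p + quat_im p \<times> quat_im q)"

definition quat_unit :: "3 \<Rightarrow> real^4" where
  "quat_unit a = quat 0 (axis a 1)"

datatype sign = Plus | Minus

fun J :: "sign \<Rightarrow> 3 \<Rightarrow> real^4^4" where
  "J Plus a = matrix (\<lambda>q. quat_mult (quat_unit a) q)"
| "J Minus a = - matrix (\<lambda>q. quat_mult q (quat_unit a))"

definition J_vec :: "sign \<Rightarrow> real^3 \<Rightarrow> real^4^4" where
  "J_vec s w = (\<Sum>a\<in>UNIV. w $ a *\<^sub>R J s a)"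

text \<open>
  A tensor \<open>R\<^sup>\<lambda>\<^sup>\<alpha>\<^sub>\<beta>\<^sub>\<mu>\<close> is the matrix with row index \<open>(\<lambda>, \<alpha>)\<close> and column index \<open>(\<beta>, \<mu>)\<close>, so that
  \<open>(R\<^sup>-\<^sup>1)\<^sup>\<alpha>\<^sup>\<lambda>\<^sub>\<mu>\<^sub>\<beta> R\<^sup>\<mu>\<^sup>\<beta>\<^sub>\<gamma>\<^sub>\<nu> = \<delta>\<^sup>\<lambda>\<^sub>\<nu> \<delta>\<^sup>\<alpha>\<^sub>\<gamma>\<close> says that \<open>R\<^sup>-\<^sup>1\<close> is the inverse matrix.
\<close>
definition R_mat :: "sign \<Rightarrow> real^3 \<Rightarrow> real \<Rightarrow> real^3 \<Rightarrow> complex^(4\<times>4)^(4\<times>4)" where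
  "R_mat s n u0 u = vec_lambda (\<lambda>(l, a). vec_lambda (\<lambda>(b, m).
     complex_of_real u0 * of_bool (l = m) * of_bool (a = b)
     + \<i> * complex_of_real (J_vec s n $ l $ m) * complex_of_real (J_vec s u $ a $ b)))"

text \<open>
  The indices of \<open>x\<^sub>1\<close> range over \<open>'a\<close> and those of \<open>x\<^sub>2\<close> over \<open>'b\<close>. Invertibility is explicit
  because \<^const>\<open>matrix_inv\<close> is unspecified on matrices that are not invertible.
\<close>
definition nc_product_of_euclidean_spaces ::
    "complex^('b::finite \<times> 'a::finite)^('a \<times> 'b) \<Rightarrow> bool" where
  "nc_product_of_euclidean_spaces R \<longleftrightarrow>
     invertible R \<and>
     (\<forall>l a b m.
        R $ (l, b) $ (a, m) = R $ (m, a) $ (b, l) \<and>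
        R $ (m, a) $ (b, l) = matrix_inv R $ (b, m) $ (l, a) \<and>
        matrix_inv R $ (b, m) $ (l, a) = cnj (R $ (m, b) $ (a, l))) \<and>
     (\<forall>l a b c d m.
        (\<Sum>r\<in>UNIV. R $ (l, a) $ (b, r) * R $ (r, d) $ (c, m)) =
        (\<Sum>r\<in>UNIV. R $ (l, d) $ (c, r) * R $ (r, a) $ (b, m))) \<and>
     (\<forall>l m n r a b.
        (\<Sum>c\<in>UNIV. R $ (l, a) $ (c, n) * R $ (m, c) $ (b, r)) =
        (\<Sum>c\<in>UNIV. R $ (m, a) $ (c, r) * R $ (l, c) $ (b, n)))"

lemma exhaust_index4: "i = 0 \<or> i = 1 \<or> i = 2 \<or> i = (3::4)"
  using exhaust_4[of i] by auto

lemma quat_nth [simp]: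
  "quat t v $ 0 = t" "quat t v $ 1 = v $ 1" "quat t v $ 2 = v $ 2" "quat t v $ 3 = v $ 3"
  by (simp_all add: quat_def)

lemma quat_im_nth [simp]:
  "quat_im q $ 1 = q $ 1" "quat_im q $ 2 = q $ 2" "quat_im q $ 3 = q $ 3"
  by (simp_all add: quat_im_def)

lemma quat_im_quat [simp]: "quat_im (quat t v) = v"
  by (simp add: vec_eq_iff forall_3)

lemma quat_eq_iff: "p = q \<longleftrightarrow> p $ 0 = q $ 0 \<and> quat_im p = quat_im q"
  by (auto simp: vec_eq_iff forall_3) (metis exhaust_index4)

lemma quat_mult_one:
  "quat_mult (quat 1 0) q = q" "quat_mult q (quat 1 0) = q"
  by (simp_all add: quat_mult_def quat_eq_iff)

lemma quat_unit_mult: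
  "quat_mult (quat_unit a) (quat_unit b) = quat (- of_bool (a = b)) (axis a 1 \<times> axis b 1)"
  by (simp add: quat_mult_def quat_unit_def inner_axis_axis)

lemma cross3_axes:
  "axis 1 1 \<times> axis 2 1 = axis 3 1" "axis 2 1 \<times> axis 3 1 = axis 1 1"
  "axis 3 1 \<times> axis 1 1 = axis 2 1"
  by (simp_all add: vec_eq_iff forall_3 cross3_simps axis_def)

lemma J_Plus_nth:
  "J Plus a $ i $ j = quat_mult (quat_unit a) (axis j 1) $ i"
  by (simp add: matrix_def)

lemma J_Minus_nth:
  "J Minus a $ i $ j = - quat_mult (axis j 1) (quat_unit a) $ i"
  by (simp add: matrix_def)

lemma quat_mult_nth:
  "quat_mult p q $ 0 = p $ 0 * q $ 0 - p $ 1 * q $ 1 - p $ 2 * q $ 2 - p $ 3 * q $ 3"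
  "quat_mult p q $ 1 = p $ 0 * q $ 1 + p $ 1 * q $ 0 + p $ 2 * q $ 3 - p $ 3 * q $ 2"
  "quat_mult p q $ 2 = p $ 0 * q $ 2 + p $ 2 * q $ 0 + p $ 3 * q $ 1 - p $ 1 * q $ 3"
  "quat_mult p q $ 3 = p $ 0 * q $ 3 + p $ 3 * q $ 0 + p $ 1 * q $ 2 - p $ 2 * q $ 1"
  by (simp_all add: quat_mult_def cross3_def inner_vec_def sum_3 algebra_simps)

lemma vec4_eq_iff:
  "p = q \<longleftrightarrow> p $ 0 = q $ 0 \<and> p $ 1 = q $ 1 \<and> p $ 2 = q $ 2 \<and> p $ (3::4) = q $ 3"
  by (auto simp: vec_eq_iff) (metis exhaust_index4)

lemma quat_mult_assoc: "quat_mult (quat_mult p q) r = quat_mult p (quat_mult q r)"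
  unfolding vec4_eq_iff quat_mult_nth by (simp add: algebra_simps)

lemma linear_quat_mult: "linear (quat_mult p)" "linear (\<lambda>q. quat_mult q p)"
  by (rule linearI; unfold vec4_eq_iff quat_mult_nth vector_add_component vector_scaleR_component;
      simp add: algebra_simps)+

lemma J_Plus_apply: "J Plus a *v q = quat_mult (quat_unit a) q"
  by (simp add: matrix_works linear_quat_mult)

lemma J_Minus_apply: "J Minus a *v q = - quat_mult q (quat_unit a)"
proof -
  have "(- A) *v q = - (A *v q)" for A :: "real^4^4"
    by (simp add: vec_eq_iff matrix_vector_mult_def sum_negf)
  then show ?thesis
    by (simp add: matrix_works linear_quat_mult)
qed

lemma J_Plus_Minus_commute: "J Plus a ** J Minus b = J Minus b ** J Plus a"
  unfolding matrix_eq matrix_vector_mul_assoc[symmetric] J_Plus_apply J_Minus_apply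
  by (simp add: linear_neg[OF linear_quat_mult(1)] quat_mult_assoc)

lemma inner_vec4: "p \<bullet> q = p $ 0 * q $ 0 + p $ 1 * q $ 1 + p $ 2 * q $ 2 + p $ 3 * (q $ (3::4) :: real)"
proof -
  have "(4::4) = 0" by simp
  then show ?thesis
    unfolding inner_vec_def sum_4 inner_real_def by (simp only: add_ac)
qed

lemma J_skew: "(J s a *v p) \<bullet> q = - (p \<bullet> (J s a *v q))"
  by (cases s) (simp_all only: J_Plus_apply J_Minus_apply inner_vec4 quat_mult_nth quat_unit_def quat_nth
      vector_uminus_component, simp_all add: algebra_simps)

lemma J_antisym: "transpose (J s a) = - J s a"
proof -
  have entry: "A $ i $ j = (A *v axis j 1) \<bullet> axis i 1" for A :: "real^4^4" and i j
    by (simp add: inner_axis matrix_vector_mult_basis column_def)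
  have *: "J s a $ j $ i = - (J s a $ i $ j)" for i j
    unfolding entry[of "J s a" j i] entry[of "J s a" i j] J_skew[of s a "axis i 1"]
    by (simp only: inner_commute)
  show ?thesis
    unfolding vec_eq_iff transpose_def vec_lambda_beta vector_uminus_component
    by (intro allI *)
qed

lemma J_vec_apply: "J_vec s w *v q = (\<Sum>a\<in>UNIV. w $ a *\<^sub>R (J s a *v q))"
  by (simp add: J_vec_def sum_3 matrix_vector_mult_add_rdistrib scaleR_matrix_vector_assoc)

lemma J_mult:
  "J s a ** J s b = - of_bool (a = b) *\<^sub>R mat 1 + J_vec s (axis a 1 \<times> axis b 1)"
proof -
  have "J s a *v (J s b *v q) =
      - of_bool (a = b) *\<^sub>R q + (\<Sum>c\<in>UNIV. (axis a 1 \<times> axis b 1) $ c *\<^sub>R (J s c *v q))" for q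
    unfolding sum_3
    by (cases s; use exhaust_3[of a] exhaust_3[of b] in
        \<open>elim disjE; simp only: J_Plus_apply J_Minus_apply vec4_eq_iff quat_mult_nth vector_uminus_component
          vector_add_component vector_scaleR_component quat_unit_def quat_nth;
          simp add: axis_def cross3_def\<close>)
  moreover have "(- of_bool (a = b) *\<^sub>R mat 1) *v q = - of_bool (a = b) *\<^sub>R q" for q :: "real^4"
    by (metis scaleR_matrix_vector_assoc matrix_vector_mul_lid)
  ultimately show ?thesis
    unfolding matrix_eq matrix_vector_mul_assoc[symmetric] matrix_vector_mult_add_rdistrib J_vec_apply
    by simp
qed

end

theory Submission
  imports Defs
begin

text \<open>
  Nothing about quaternions matters beyond two facts: every \<open>J\<^sub>w\<close> is antisymmetric, and
  \<open>J\<^sub>w\<^sup>2 = - \<bar>w\<bar>\<^sup>2\<close>. So consider any tensor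
  \<open>R\<^sup>\<lambda>\<^sup>\<alpha>\<^sub>\<beta>\<^sub>\<mu> = c \<delta>\<^sup>\<lambda>\<^sub>\<mu> \<delta>\<^sup>\<alpha>\<^sub>\<beta> + \<i> A\<^sup>\<lambda>\<^sub>\<mu> B\<^sup>\<alpha>\<^sub>\<beta>\<close> with \<open>c\<close> real and
  \<open>A\<close>, \<open>B\<close> real antisymmetric matrices.

  Up to the flip of the two factors, \<open>R\<close> is the operator \<open>c + \<i> A \<otimes> B\<close>. If \<open>A\<^sup>2 = - a\<close> and
  \<open>B\<^sup>2 = - b\<close>, then \<open>(c + \<i> A \<otimes> B) (c - \<i> A \<otimes> B) = c\<^sup>2 + A\<^sup>2 \<otimes> B\<^sup>2 = c\<^sup>2 + a b\<close>, so that
  under \<open>c\<^sup>2 + a b = 1\<close> the inverse of \<open>R\<close> is its flipped conjugate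
  (\<open>nc_product_of_antisymmetric\<close>). The equalities between \<open>R\<close>, its transpose, its inverse and its
  conjugate then express the antisymmetry of \<open>A\<close> and \<open>B\<close>. The two quadratic relations
  (\<open>quadratic_relation_left\<close>, \<open>quadratic_relation_right\<close>) hold for arbitrary \<open>A\<close> and \<open>B\<close>: they say
  that operators \<open>c + \<i> A \<otimes> B\<close> which share one tensor factor and act on different copies of
  the other commute, as \<open>A\<close> commutes with itself and so does \<open>B\<close>.

  For \<open>A = J\<^sub>n\<close> and \<open>B = J\<^sub>u\<close> the condition reads \<open>c\<^sup>2 + \<bar>n\<bar>\<^sup>2 \<bar>u\<bar>\<^sup>2 = 1\<close>, which is
  \<open>(u\<^sup>0)\<^sup>2 + (u\<^sup>1)\<^sup>2 + (u\<^sup>2)\<^sup>2 = 1\<close> because \<open>n\<^sub>1\<close>, \<open>n\<^sub>2\<close> are orthonormal.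
\<close>

lemma J_vec_Plus_apply: "J_vec Plus w *v q = quat_mult (quat 0 w) q"
  unfolding J_vec_apply sum_3 J_Plus_apply vec4_eq_iff quat_mult_nth
    vector_add_component vector_scaleR_component quat_unit_def quat_nth
  by (simp add: axis_def algebra_simps)

lemma J_vec_Minus_apply: "J_vec Minus w *v q = - quat_mult q (quat 0 w)"
  unfolding J_vec_apply sum_3 J_Minus_apply vec4_eq_iff quat_mult_nth
    vector_add_component vector_scaleR_component vector_uminus_component quat_unit_def quat_nth
  by (simp add: axis_def algebra_simps)

text \<open>
  The purely imaginary quaternion \<open>w\<close> has square \<open>- \<bar>w\<bar>\<^sup>2\<close>; by associativity so do left and
  right multiplication by it.
\<close>
lemma J_vec_square: "J_vec s w ** J_vec s w = - (w \<bullet> w) *\<^sub>R mat 1"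
proof -
  have square: "quat_mult (quat 0 w) (quat 0 w) = quat (- (w \<bullet> w)) 0"
    by (simp add: quat_mult_def)
  have scalar: "quat_mult (quat t 0) q = t *\<^sub>R q" "quat_mult q (quat t 0) = t *\<^sub>R q" for t q
    by (simp_all add: vec4_eq_iff quat_mult_nth)
  have "J_vec s w *v (J_vec s w *v q) = - (w \<bullet> w) *\<^sub>R q" for q
  proof (cases s)
    case Plus
    then show ?thesis
      by (simp only: J_vec_Plus_apply quat_mult_assoc[symmetric] square scalar)
  next
    case Minus
    then show ?thesis
      by (simp only: J_vec_Minus_apply linear_neg[OF linear_quat_mult(2)] quat_mult_assoc square
          scalar minus_minus)
  qed
  moreover have "(- (w \<bullet> w) *\<^sub>R mat 1) *v q = - (w \<bullet> w) *\<^sub>R q" for q :: "real^4"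
    by (metis scaleR_matrix_vector_assoc matrix_vector_mul_lid)
  ultimately show ?thesis
    unfolding matrix_eq matrix_vector_mul_assoc[symmetric] by simp
qed

lemma J_vec_antisym: "J_vec s w $ j $ i = - J_vec s w $ i $ j"
proof -
  have "J s a $ j $ i = - J s a $ i $ j" for a
    using arg_cong[OF J_antisym[of s a], of "\<lambda>M. M $ i $ j"] by (simp add: transpose_def)
  then show ?thesis
    by (simp add: J_vec_def sum_negf)
qed

lemma matrix_inv_eq:
  assumes "A ** B = mat 1" and "B ** A = mat 1"
  shows "matrix_inv A = B"
proof -
  have "A ** matrix_inv A = mat 1"
    unfolding matrix_inv_def
    using someI[of "\<lambda>A'. A ** A' = mat 1 \<and> A' ** A = mat 1" B] assms by simp
  then show ?thesis
    by (metis assms(2) matrix_mul_assoc matrix_mul_lid matrix_mul_rid)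
qed

lemma sum_over_pairs:
  "(\<Sum>p\<in>UNIV. f p) = (\<Sum>x\<in>(UNIV :: 'a::finite set). \<Sum>y\<in>(UNIV :: 'b::finite set). f (x, y))"
  by (simp add: sum.cartesian_product)

text \<open>
  The product of \<open>p + q A \<otimes> B\<close> and \<open>p' + q' A \<otimes> B\<close>, entry by entry.
\<close>
lemma sum_two_tensors:
  fixes p q p' q' :: complex and A :: "real^'a^'a" and B :: "real^'b^'b"
  shows "(\<Sum>j\<in>UNIV. \<Sum>y\<in>UNIV.
      (p * of_bool (i = j) * of_bool (x = y) + q * of_real (A $ i $ j) * of_real (B $ x $ y)) *
      (p' * of_bool (j = k) * of_bool (y = z) + q' * of_real (A $ j $ k) * of_real (B $ y $ z))) =
    p * p' * of_bool (i = k) * of_bool (x = z)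
    + (p * q' + q * p') * of_real (A $ i $ k) * of_real (B $ x $ z)
    + q * q' * of_real ((A ** A) $ i $ k) * of_real ((B ** B) $ x $ z)"
    (is "?sum = _")
proof -
  define \<delta> :: "'a \<Rightarrow> 'a \<Rightarrow> complex" where "\<delta> i j = of_bool (i = j)" for i j
  define \<epsilon> :: "'b \<Rightarrow> 'b \<Rightarrow> complex" where "\<epsilon> x y = of_bool (x = y)" for x y
  define C where "C i j = complex_of_real (A $ i $ j)" for i j
  define D where "D x y = complex_of_real (B $ x $ y)" for x y
  have expand: "(\<Sum>j\<in>UNIV. \<Sum>y\<in>UNIV. (p * \<delta> i j * \<epsilon> x y + q * C i j * D x y) *
      (p' * \<delta> j k * \<epsilon> y z + q' * C j k * D y z)) =
    p * p' * ((\<Sum>j\<in>UNIV. \<delta> i j * \<delta> j k) * (\<Sum>y\<in>UNIV. \<epsilon> x y * \<epsilon> y z))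
    + p * q' * ((\<Sum>j\<in>UNIV. \<delta> i j * C j k) * (\<Sum>y\<in>UNIV. \<epsilon> x y * D y z))
    + q * p' * ((\<Sum>j\<in>UNIV. C i j * \<delta> j k) * (\<Sum>y\<in>UNIV. D x y * \<epsilon> y z))
    + q * q' * ((\<Sum>j\<in>UNIV. C i j * C j k) * (\<Sum>y\<in>UNIV. D x y * D y z))"
    unfolding sum_product unfolding sum_distrib_left sum.distrib[symmetric]
    by (intro sum.cong refl) (simp add: algebra_simps)
  have unit: "(\<Sum>j\<in>UNIV. \<delta> i j * f j) = f i" "(\<Sum>j\<in>UNIV. f j * \<delta> j k) = f k"
      "(\<Sum>y\<in>UNIV. \<epsilon> x y * g y) = g x" "(\<Sum>y\<in>UNIV. g y * \<epsilon> y z) = g z" for f g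
    by (simp_all add: \<delta>_def \<epsilon>_def)
  have square: "(\<Sum>j\<in>UNIV. C i j * C j k) = of_real ((A ** A) $ i $ k)"
      "(\<Sum>y\<in>UNIV. D x y * D y z) = of_real ((B ** B) $ x $ z)"
    by (simp_all add: C_def D_def matrix_matrix_mult_def)
  have "?sum = p * p' * \<delta> i k * \<epsilon> x z + (p * q' + q * p') * C i k * D x z
      + q * q' * of_real ((A ** A) $ i $ k) * of_real ((B ** B) $ x $ z)"
    using expand unfolding unit square unfolding \<delta>_def \<epsilon>_def C_def D_def
    by (simp only: distrib_right mult.assoc add.assoc)
  then show ?thesis
    by (simp only: \<delta>_def \<epsilon>_def C_def D_def)
qed

lemma quadratic_relation_left:
  fixes R :: "complex^('b::finite \<times> 'a::finite)^('a \<times> 'b)" and A :: "real^'a^'a" and B :: "real^'b^'b"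
  assumes R: "\<And>l a b m. R $ (l, a) $ (b, m) =
    c * of_bool (l = m) * of_bool (a = b) + \<i> * of_real (A $ l $ m) * of_real (B $ a $ b)"
  shows "(\<Sum>r\<in>UNIV. R $ (l, a) $ (b, r) * R $ (r, d) $ (e, m)) =
    (\<Sum>r\<in>UNIV. R $ (l, d) $ (e, r) * R $ (r, a) $ (b, m))"
proof -
  have product: "(\<Sum>r\<in>UNIV. R $ (l, a) $ (b, r) * R $ (r, d) $ (e, m)) =
      c\<^sup>2 * of_bool (l = m) * of_bool (a = b) * of_bool (d = e)
      + \<i> * c * of_real (A $ l $ m) *
        (of_bool (a = b) * of_real (B $ d $ e) + of_real (B $ a $ b) * of_bool (d = e))
      - of_real ((A ** A) $ l $ m) * of_real (B $ a $ b) * of_real (B $ d $ e)" for a b d e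
  proof -
    have "(\<Sum>r\<in>UNIV. R $ (l, a) $ (b, r) * R $ (r, d) $ (e, m)) =
        c\<^sup>2 * of_bool (a = b) * of_bool (d = e) * (\<Sum>r\<in>UNIV. of_bool (l = r) * of_bool (r = m))
        + \<i> * c * of_bool (a = b) * of_real (B $ d $ e) *
            (\<Sum>r\<in>UNIV. of_bool (l = r) * of_real (A $ r $ m))
        + \<i> * c * of_real (B $ a $ b) * of_bool (d = e) *
            (\<Sum>r\<in>UNIV. of_real (A $ l $ r) * of_bool (r = m))
        + \<i>\<^sup>2 * of_real (B $ a $ b) * of_real (B $ d $ e) *
            (\<Sum>r\<in>UNIV. of_real (A $ l $ r) * of_real (A $ r $ m))"
      unfolding R sum_distrib_left sum.distrib[symmetric]
      by (intro sum.cong refl) (simp only: algebra_simps power2_eq_square)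
    also have "(\<Sum>r\<in>UNIV. of_real (A $ l $ r) * of_real (A $ r $ m)) =
        complex_of_real ((A ** A) $ l $ m)"
      by (simp add: matrix_matrix_mult_def)
    finally show ?thesis
      by (simp add: distrib_left mult_ac)
  qed
  show ?thesis
    unfolding product by (simp add: algebra_simps)
qed

lemma quadratic_relation_right:
  fixes R :: "complex^('b::finite \<times> 'a::finite)^('a \<times> 'b)" and A :: "real^'a^'a" and B :: "real^'b^'b"
  assumes R: "\<And>l a b m. R $ (l, a) $ (b, m) =
    c * of_bool (l = m) * of_bool (a = b) + \<i> * of_real (A $ l $ m) * of_real (B $ a $ b)"
  shows "(\<Sum>e\<in>UNIV. R $ (l, a) $ (e, n) * R $ (m, e) $ (b, r)) =
    (\<Sum>e\<in>UNIV. R $ (m, a) $ (e, r) * R $ (l, e) $ (b, n))"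
proof -
  \<comment> \<open>Exchanging the roles of the two factors turns this relation into the other one.\<close>
  define S :: "complex^('a \<times> 'b)^('b \<times> 'a)" where
    "S = (\<chi> i j. R $ (snd i, fst i) $ (snd j, fst j))"
  have S: "S $ (a, l) $ (m, b) = R $ (l, a) $ (b, m)" for a l m b
    by (simp add: S_def)
  have "(\<Sum>e\<in>UNIV. S $ (a, l) $ (n, e) * S $ (e, m) $ (r, b)) =
      (\<Sum>e\<in>UNIV. S $ (a, m) $ (r, e) * S $ (e, l) $ (n, b))"
    by (rule quadratic_relation_left[of S c B A]) (simp add: S R)
  then show ?thesis
    by (simp add: S)
qed

text \<open>
  The general form of the theorem, for two spaces of arbitrary finite dimensions. The inverse
  matrix is \<open>c - \<i> A \<otimes> B\<close>, with rows and columns indexed in the flipped order.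
\<close>
lemma nc_product_of_antisymmetric:
  fixes R :: "complex^('b::finite \<times> 'a::finite)^('a \<times> 'b)" and A :: "real^'a^'a" and B :: "real^'b^'b"
    and a b c :: real
  assumes R: "\<And>l x y m. R $ (l, x) $ (y, m) =
      of_real c * of_bool (l = m) * of_bool (x = y)
      + \<i> * of_real (A $ l $ m) * of_real (B $ x $ y)"
    and A: "\<And>l m. A $ m $ l = - A $ l $ m" and B: "\<And>x y. B $ y $ x = - B $ x $ y"
    and AA: "A ** A = - a *\<^sub>R mat 1" and BB: "B ** B = - b *\<^sub>R mat 1"
    and c: "c\<^sup>2 + a * b = 1"
  shows "nc_product_of_euclidean_spaces R"
proof -
  define S :: "complex^('a \<times> 'b)^('b \<times> 'a)" where
    "S = vec_lambda (\<lambda>(x, l). vec_lambda (\<lambda>(m, y). of_real c * of_bool (l = m) * of_bool (x = y)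
      + (- \<i>) * of_real (A $ l $ m) * of_real (B $ x $ y)))"
  have S: "S $ (x, l) $ (m, y) = of_real c * of_bool (l = m) * of_bool (x = y)
      + (- \<i>) * of_real (A $ l $ m) * of_real (B $ x $ y)" for x l m y
    by (simp add: S_def)
  have c': "complex_of_real c * of_real c + of_real a * of_real b = 1"
    using c by (metis of_real_1 of_real_add of_real_mult power2_eq_square)
  have squares: "(A ** A) $ l $ m = - a * of_bool (l = m)" "(B ** B) $ x $ y = - b * of_bool (x = y)"
    for l m x y
    by (simp_all add: AA BB mat_def)
  have RS: "R ** S = mat 1"
  proof -
    have "(R ** S) $ (l, x) $ (m, y) = of_bool (l = m \<and> x = y)" for l x m y
    proof -
      have "(R ** S) $ (l, x) $ (m, y) =
          (\<Sum>z\<in>UNIV. \<Sum>k\<in>UNIV. R $ (l, x) $ (z, k) * S $ (z, k) $ (m, y))"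
        by (simp add: matrix_matrix_mult_def sum_over_pairs)
      also have "\<dots> = (\<Sum>k\<in>UNIV. \<Sum>z\<in>UNIV. R $ (l, x) $ (z, k) * S $ (z, k) $ (m, y))"
        by (rule sum.swap)
      also have "\<dots> = of_bool (l = m \<and> x = y)"
        unfolding R S sum_two_tensors squares using c' by simp
      finally show ?thesis .
    qed
    then show ?thesis
      by (auto simp: vec_eq_iff mat_def)
  qed
  have SR: "S ** R = mat 1"
  proof -
    have "(S ** R) $ (x, l) $ (y, m) = of_bool (l = m \<and> x = y)" for l x m y
    proof -
      have "(S ** R) $ (x, l) $ (y, m) =
          (\<Sum>k\<in>UNIV. \<Sum>z\<in>UNIV. S $ (x, l) $ (k, z) * R $ (k, z) $ (y, m))"
        by (simp add: matrix_matrix_mult_def sum_over_pairs)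
      also have "\<dots> = of_bool (l = m \<and> x = y)"
        unfolding R S sum_two_tensors squares using c' by simp
      finally show ?thesis .
    qed
    then show ?thesis
      by (auto simp: vec_eq_iff mat_def)
  qed
  have inv: "invertible R"
    using RS SR unfolding invertible_def by blast
  have inv_eq: "matrix_inv R = S"
    by (rule matrix_inv_eq[OF RS SR])
  have flip: "R $ (l, y) $ (x, m) = R $ (m, x) $ (y, l)" for l x y m
    unfolding R A[of l m] B[of x y] by (auto simp: eq_commute)
  have inverse: "R $ (m, x) $ (y, l) = S $ (y, m) $ (l, x)" for l x y m
    unfolding R S B[of y x] by (auto simp: eq_commute)
  have conjugate: "S $ (y, m) $ (l, x) = cnj (R $ (m, y) $ (x, l))" for l x y m
    unfolding R S by simp
  show ?thesis
    unfolding nc_product_of_euclidean_spaces_def inv_eq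
    by (intro conjI allI inv flip inverse conjugate quadratic_relation_left[OF R]
        quadratic_relation_right[OF R])
qed

theorem mainTheorem3:
  fixes n1 n2 u :: "real^3" and u0 u1 u2 :: real and s :: sign
    and R :: "complex^(4\<times>4)^(4\<times>4)"
  assumes "norm n1 = 1" and "norm n2 = 1" and "orthogonal n1 n2"
    and "u0^2 + u1^2 + u2^2 = 1"
    and "u = u1 *\<^sub>R n1 + u2 *\<^sub>R n2"
    and "R = R_mat s n1 u0 u"
  shows "invertible R \<and>
    (\<forall>l a b m.
       R $ (l, b) $ (a, m) = R $ (m, a) $ (b, l) \<and>
       R $ (m, a) $ (b, l) = matrix_inv R $ (b, m) $ (l, a) \<and>
       matrix_inv R $ (b, m) $ (l, a) = cnj (R $ (m, b) $ (a, l))) \<and>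
    (\<forall>l a b c d m.
       (\<Sum>r\<in>UNIV. R $ (l, a) $ (b, r) * R $ (r, d) $ (c, m)) =
       (\<Sum>r\<in>UNIV. R $ (l, d) $ (c, r) * R $ (r, a) $ (b, m))) \<and>
    (\<forall>l m n r a b.
       (\<Sum>c\<in>UNIV. R $ (l, a) $ (c, n) * R $ (m, c) $ (b, r)) =
       (\<Sum>c\<in>UNIV. R $ (m, a) $ (c, r) * R $ (l, c) $ (b, n))) \<and>
    nc_product_of_euclidean_spaces R"
proof -
  have n: "n1 \<bullet> n1 = 1" "n2 \<bullet> n2 = 1" "n1 \<bullet> n2 = 0" "n2 \<bullet> n1 = 0"
    using assms(1-3) by (auto simp: norm_eq_1 orthogonal_def inner_commute)
  have "u \<bullet> u = u1\<^sup>2 + u2\<^sup>2"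
    by (simp add: assms(5) inner_add_left inner_add_right n power2_eq_square)
  then have unit: "u0\<^sup>2 + (n1 \<bullet> n1) * (u \<bullet> u) = 1"
    using assms(4) n(1) by simp
  have R: "R $ (l, a) $ (b, m) = of_real u0 * of_bool (l = m) * of_bool (a = b)
      + \<i> * of_real (J_vec s n1 $ l $ m) * of_real (J_vec s u $ a $ b)" for l a b m
    by (simp add: assms(6) R_mat_def)
  have nc: "nc_product_of_euclidean_spaces R"
    by (rule nc_product_of_antisymmetric[OF R J_vec_antisym J_vec_antisym J_vec_square J_vec_square unit])
  show ?thesis
    using nc nc[unfolded nc_product_of_euclidean_spaces_def] by (elim conjE) (intro conjI; assumption)
qed

end
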